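(* Let $m>0$ be fixed. There exists a unique $M=M(m)>2$ such that: for every $C\in(-\infty,M)$ there exists a unique smooth solution $v(\cdot;C):[1,m+1]\to\mathbb{R}$ of the initial value problem $$v'=2\sqrt{2}\,\sqrt{v}+p_C(\gamma)\,\gamma,\qquad v(1)=2,$$ such that $\lim_{C\to-\infty}v(m+1;C)=\infty$ and $\lim_{C\to M^-}v(m+1;C)=0$; and for every $C\ge M$ there exists a unique smooth solution $v(\cdot;C):[1,\gamma_{\star,C})\to\mathbb{R}$ of this initial value problem, for a unique $\gamma_{\star,C}\in(1,m+1]$, such that $v(\cdot;C)$ cannot be continued smoothly beyond $\gamma_{\star,C}$. Further, there exists a unique $C=C(m)\in(-\infty,M)$ such that $v(m+1;C)=2(m+1)^2$, and the $C$ with this property has to be strictly greater than $2$.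
   Context: For fixed real $m>0$ and $C\in\mathbb{R}$ put $$A(C)=\frac{3C}{m}\left[1-\frac{1}{(m+1)^2}\right]-\frac{6}{m}\left[1+\frac{1}{(m+1)^2}\right],$$ $$B(C)=-2C\left[1+\frac1m-\frac{1}{m(m+1)^2}\right]+4\left[1+\frac1m+\frac{1}{m(m+1)^2}\right],$$ $$p_C(\gamma)=A(C)\frac{\gamma^3}{3}+B(C)\frac{\gamma^2}{2}+C.$$ Solutions are real functions of $\gamma$ on subintervals of $[1,m+1]$ containing $1$, and $'$ is the derivative in $\gamma$. "Smooth" means $\mathcal{C}^\infty$ on the stated interval, including (with one-sided derivatives) at those endpoints which belong to it. A smooth solution on $[1,r)$ "can be continued smoothly beyond $r$" if it extends to a smooth solution on an interval containing $[1,r]$. *)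

theory Defs
  imports "HOL-Analysis.Analysis" "HOL-Library.FuncSet"
begin

definition coeff_A :: "real \<Rightarrow> real \<Rightarrow> real" where
  "coeff_A m C = 3 * C / m * (1 - 1 / (m + 1)^2) - 6 / m * (1 + 1 / (m + 1)^2)"

definition coeff_B :: "real \<Rightarrow> real \<Rightarrow> real" where
  "coeff_B m C = - 2 * C * (1 + 1 / m - 1 / (m * (m + 1)^2))
     + 4 * (1 + 1 / m + 1 / (m * (m + 1)^2))"

definition poly_p :: "real \<Rightarrow> real \<Rightarrow> real \<Rightarrow> real" where
  "poly_p m C \<gamma> = coeff_A m C * \<gamma>^3 / 3 + coeff_B m C * \<gamma>^2 / 2 + C"

(* D n is the n-th derivative of f on I; "at x within I" makes it one-sided at endpoints
   of I that belong to I.  Intended for intervals with more than one point. *)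
definition smooth_on_interval :: "(real \<Rightarrow> real) \<Rightarrow> real set \<Rightarrow> bool" where
  "smooth_on_interval f I \<longleftrightarrow>
     (\<exists>D :: nat \<Rightarrow> real \<Rightarrow> real.
        (\<forall>x\<in>I. D 0 x = f x) \<and>
        (\<forall>n. \<forall>x\<in>I. (D n has_real_derivative D (Suc n) x) (at x within I)))"

(* Membership in "extensional I" identifies v with a function on I, so that equality of
   solutions means equality on I.  Nonnegativity of v is required explicitly because sqrt
   is total on the reals, with sqrt (- x) = - sqrt x. *)
definition ivp_solution :: "real \<Rightarrow> real \<Rightarrow> real set \<Rightarrow> (real \<Rightarrow> real) \<Rightarrow> bool" where
  "ivp_solution m C I v \<longleftrightarrow>
     is_interval I \<and> 1 \<in> I \<and> I \<subseteq> {1..m + 1} \<and> v \<in> extensional I \<and>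
     smooth_on_interval v I \<and>
     (\<forall>\<gamma>\<in>I. 0 \<le> v \<gamma> \<and>
        (v has_real_derivative 2 * sqrt 2 * sqrt (v \<gamma>) + poly_p m C \<gamma> * \<gamma>) (at \<gamma> within I)) \<and>
     v 1 = 2"

definition continuable_beyond :: "real \<Rightarrow> real \<Rightarrow> real \<Rightarrow> (real \<Rightarrow> real) \<Rightarrow> bool" where
  "continuable_beyond m C r v \<longleftrightarrow>
     (\<exists>J w. {1..r} \<subseteq> J \<and> ivp_solution m C J w \<and> (\<forall>\<gamma>\<in>{1..<r}. w \<gamma> = v \<gamma>))"

definition maximal_solution :: "real \<Rightarrow> real \<Rightarrow> real \<Rightarrow> (real \<Rightarrow> real) \<Rightarrow> bool" where
  "maximal_solution m C r v \<longleftrightarrow>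
     ivp_solution m C {1..<r} v \<and> \<not> continuable_beyond m C r v"

(* v(.;C) on the whole of [1,m+1]; only meaningful where this solution exists and is unique. *)
definition full_solution :: "real \<Rightarrow> real \<Rightarrow> real \<Rightarrow> real" where
  "full_solution m C = (THE v. ivp_solution m C {1..m + 1} v)"

definition is_threshold :: "real \<Rightarrow> real \<Rightarrow> bool" where
  "is_threshold m M \<longleftrightarrow>
     (\<forall>C<M. \<exists>!v. ivp_solution m C {1..m + 1} v) \<and>
     filterlim (\<lambda>C. full_solution m C (m + 1)) at_top at_bot \<and>
     ((\<lambda>C. full_solution m C (m + 1)) \<longlongrightarrow> 0) (at_left M) \<and>
     (\<forall>C\<ge>M. \<exists>r v. r \<in> {1<..m + 1} \<and> maximal_solution m C r v \<and>
        (\<forall>w. ivp_solution m C {1..<r} w \<longrightarrow> w = v) \<and>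
        (\<forall>r' w. r' \<in> {1<..m + 1} \<and> maximal_solution m C r' w \<longrightarrow> r' = r))"

end

theory Submission
  imports Defs
begin

text \<open>
  Replacing \<open>sqrt v\<close> by \<open>sqrt (max v 0)\<close> turns the problem into one that has a
  unique solution \<open>v\<^sub>C\<close> on all of \<open>[1, m + 1]\<close> for every \<open>C\<close>. Existence follows by monotone
  Picard iteration downwards from a large constant, because the right-hand side is increasing
  and sublinear in \<open>v\<close>. Along \<open>[1, m + 1]\<close> the polynomial \<open>p\<^sub>C\<close> changes sign exactly once, from
  positive to negative, so \<open>v\<^sub>C\<close> can only reach zero where \<open>p\<^sub>C < 0\<close>: it crosses transversally and
  stays negative. This yields uniqueness, and shows that \<open>v\<^sub>C\<close> is positive on \<open>[1, m + 1]\<close>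
  iff \<open>v\<^sub>C(m + 1) > 0\<close>.

  Since \<open>p\<^sub>C\<close> is affine in \<open>C\<close> with negative slope on \<open>(1, m + 1)\<close>, the end value \<open>v\<^sub>C(m + 1)\<close> is
  continuous and strictly decreasing in \<open>C\<close>, from \<open>\<infinity>\<close> to negative values, and \<open>M\<close> is its zero.
  At a zero \<open>r\<close> of \<open>v\<^sub>C\<close> smoothness fails: were \<open>v'\<close> differentiable at \<open>r\<close>, then so would be \<open>sqrt v\<close>
  by the equation, hence \<open>v'(r) = 0\<close>, whereas \<open>v'(r) = r p\<^sub>C(r) < 0\<close>. For \<open>C = 2\<close> the function
  \<open>2 \<gamma>\<^sup>2\<close> plus the primitive of \<open>\<gamma> p\<^sub>2\<close> is a subsolution, which gives \<open>v\<^sub>2(m + 1) > 2 (m + 1)\<^sup>2\<close>.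
\<close>

section \<open>The equation with truncated square root\<close>

text \<open>The point \<open>s\<close> is the maximum of the compact set where
  \<open>0 \<le> w\<close>; the intermediate value theorem gives a zero in \<open>{s..b}\<close>,
  which maximality forces to be \<open>s\<close>.\<close>

lemma last_crossing:
  fixes w :: "real \<Rightarrow> real"
  assumes "a \<le> b" "continuous_on {a..b} w" "0 \<le> w a" "w b < 0"
  obtains s where "a \<le> s" "s < b" "w s = 0" "\<And>x. s < x \<Longrightarrow> x \<le> b \<Longrightarrow> w x < 0"
proof -
  define S where "S = {x \<in> {a..b}. 0 \<le> w x}"
  have "closed S"
    unfolding S_def using assms(2)
    by (intro closed_Collect_le continuous_on_closed_Collect_le) auto
  moreover have "bounded S"
    by (rule bounded_subset[of "{a..b}"]) (auto simp: S_def)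
  ultimately have "compact S"
    by (simp add: compact_eq_bounded_closed)
  moreover have "S \<noteq> {}"
    using assms by (auto simp: S_def)
  ultimately obtain s where s: "s \<in> S" "\<And>x. x \<in> S \<Longrightarrow> x \<le> s"
    by (meson compact_attains_sup)
  have sb: "s < b"
    using s(1) assms(4) by (cases "s = b") (auto simp: S_def)
  have "\<exists>x\<ge>s. x \<le> b \<and> w x = 0"
    using s(1) assms sb
    by (intro IVT2') (auto simp: S_def intro: continuous_on_subset)
  then obtain x where x: "s \<le> x" "x \<le> b" "w x = 0"
    by blast
  then have "x \<in> S"
    using s(1) by (auto simp: S_def)
  then have "x = s"
    using s(2) x(1) by force
  then have "w s = 0"
    using x by simp
  moreover have "w x < 0" if "s < x" "x \<le> b" for x
  proof (rule ccontr)
    assume "\<not> w x < 0"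
    then have "x \<in> S"
      using s(1) that by (auto simp: S_def)
    then show False
      using s(2) that by force
  qed
  ultimately show thesis
    using that s(1) sb by (auto simp: S_def)
qed

text \<open>The \<open>max\<close> is there because the total function \<open>sqrt\<close> is odd;
  with it the nonlinearity is nonnegative and vanishes on negative arguments.\<close>

definition drift :: "real \<Rightarrow> real" where
  "drift y = 2 * sqrt 2 * sqrt (max y 0)"

lemma drift_nonneg: "0 \<le> drift y"
  by (simp add: drift_def)

lemma drift_mono: "y \<le> z \<Longrightarrow> drift y \<le> drift z"
  unfolding drift_def by (intro mult_left_mono real_sqrt_le_mono) auto

lemma drift_nonpos: "y \<le> 0 \<Longrightarrow> drift y = 0"
  by (simp add: drift_def max_def)

lemma drift_eq: "0 \<le> y \<Longrightarrow> drift y = 2 * sqrt 2 * sqrt y"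
  by (simp add: drift_def)

lemma continuous_on_drift [continuous_intros]:
  "continuous_on S v \<Longrightarrow> continuous_on S (\<lambda>x. drift (v x))"
  unfolding drift_def by (intro continuous_intros)

text \<open>Rests on \<open>(sqrt u - sqrt z) * (sqrt u + sqrt z) = u - z\<close>, whose second
  factor is at least \<open>sqrt d\<close>. Only the larger argument has to stay away from
  zero.\<close>

lemma drift_lipschitz:
  assumes "0 < d" "d \<le> u" "y \<le> u"
  shows "drift u - drift y \<le> 2 * sqrt 2 / sqrt d * (u - y)"
proof -
  define z where "z = max y 0"
  have z: "0 \<le> z" "z \<le> u" "y \<le> z"
    using assms by (auto simp: z_def)
  have "(sqrt u - sqrt z) * sqrt d \<le> (sqrt u - sqrt z) * (sqrt u + sqrt z)"
    using assms z by (intro mult_left_mono) (auto intro: order_trans[of _ "sqrt u"])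
  also have "\<dots> = u - z"
    using assms z by (simp add: algebra_simps)
  also have "\<dots> \<le> u - y"
    using z by simp
  finally have "sqrt u - sqrt z \<le> (u - y) / sqrt d"
    using assms by (simp add: field_simps)
  then have "2 * sqrt 2 * (sqrt u - sqrt z) \<le> 2 * sqrt 2 * ((u - y) / sqrt d)"
    by (intro mult_left_mono) auto
  then show ?thesis
    using assms by (simp add: drift_def z_def algebra_simps)
qed

text \<open>A Gronwall argument despite the infinite slope of \<open>drift\<close> at 0: the minimum
  of \<open>U\<close> is positive and yields a Lipschitz constant \<open>K\<close>, while
  \<open>V\<close> may have any sign. Past the last crossing, \<open>w = V - U\<close> satisfies
  \<open>w' \<ge> K * w\<close>, so \<open>w * exp (- K * x)\<close> cannot fall below zero.\<close>

lemma comparison: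
  assumes "a \<le> b"
    and V: "\<And>x. x \<in> {a..b} \<Longrightarrow> (V has_real_derivative V' x) (at x within {a..b})"
    and U: "\<And>x. x \<in> {a..b} \<Longrightarrow> (U has_real_derivative U' x) (at x within {a..b})"
    and V': "\<And>x. x \<in> {a..b} \<Longrightarrow> drift (V x) + h x \<le> V' x"
    and U': "\<And>x. x \<in> {a..b} \<Longrightarrow> U' x \<le> drift (U x) + h x"
    and pos: "\<And>x. x \<in> {a..b} \<Longrightarrow> 0 < U x"
    and "U a \<le> V a"
  shows "U b \<le> V b"
proof (rule ccontr)
  assume less: "\<not> U b \<le> V b"
  have cV: "continuous_on {a..b} V" and cU: "continuous_on {a..b} U"
    by (blast intro: DERIV_continuous_on V U)+
  obtain x0 where x0: "x0 \<in> {a..b}" "\<And>x. x \<in> {a..b} \<Longrightarrow> U x0 \<le> U x"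
    using continuous_attains_inf[of "{a..b}" U] cU \<open>a \<le> b\<close> by auto
  define K where "K = 2 * sqrt 2 / sqrt (U x0)"
  define w where "w = (\<lambda>x. V x - U x)"
  have cw: "continuous_on {a..b} w"
    unfolding w_def by (intro continuous_intros cV cU)
  obtain s where s: "a \<le> s" "s < b" "w s = 0" "\<And>x. s < x \<Longrightarrow> x \<le> b \<Longrightarrow> w x < 0"
    using last_crossing[OF \<open>a \<le> b\<close> cw] \<open>U a \<le> V a\<close> less by (auto simp: w_def)
  have "w s * exp (- K * s) \<le> w b * exp (- K * b)"
  proof (rule DERIV_nonneg_imp_increasing_open[where f = "\<lambda>x. w x * exp (- K * x)"])
    show "s \<le> b" using s by simp
    show "continuous_on {s..b} (\<lambda>x. w x * exp (- K * x))"
      using s by (intro continuous_intros continuous_on_subset[OF cw]) auto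
    fix x assume x: "s < x" "x < b"
    then have xin: "x \<in> {a..b}" and atx: "at x within {a..b} = at x"
      using s by (auto intro: at_within_Icc_at)
    have "((\<lambda>x. w x * exp (- K * x)) has_real_derivative (V' x - U' x - K * w x) * exp (- K * x)) (at x)"
      unfolding w_def using V[OF xin] U[OF xin] unfolding atx
      by (auto intro!: derivative_eq_intros simp: algebra_simps)
    moreover have "drift (U x) - drift (V x) \<le> K * (U x - V x)"
      unfolding K_def using drift_lipschitz[of "U x0" "U x" "V x"] pos x0 xin s(4)[of x] x
      by (auto simp: w_def)
    then have "0 \<le> V' x - U' x - K * w x"
      using V'[OF xin] U'[OF xin] by (simp add: w_def algebra_simps)
    ultimately show "\<exists>y. ((\<lambda>x. w x * exp (- K * x)) has_real_derivative y) (at x) \<and> 0 \<le> y"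
      by (meson exp_ge_zero mult_nonneg_nonneg)
  qed
  with s have "0 \<le> w b * exp (- K * b)"
    by simp
  then show False
    using s(4)[of b] s(2) by (simp add: zero_le_mult_iff)
qed

section \<open>Solutions of the truncated equation: integral form, limits and existence\<close>

definition root_ode :: "(real \<Rightarrow> real) \<Rightarrow> real \<Rightarrow> real \<Rightarrow> (real \<Rightarrow> real) \<Rightarrow> bool" where
  "root_ode h a b v \<longleftrightarrow>
     (\<forall>x\<in>{a..b}. (v has_real_derivative drift (v x) + h x) (at x within {a..b}))"

lemma root_odeD:
  "root_ode h a b v \<Longrightarrow> x \<in> {a..b} \<Longrightarrow>
    (v has_real_derivative drift (v x) + h x) (at x within {a..b})"
  by (simp add: root_ode_def)

lemma root_ode_continuous_on: "root_ode h a b v \<Longrightarrow> continuous_on {a..b} v"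
  by (auto simp: root_ode_def intro!: DERIV_continuous_on)

lemma root_ode_DERIV:
  assumes "root_ode h a b v" "a < x" "x < b"
  shows "(v has_real_derivative drift (v x) + h x) (at x)"
  using root_odeD[OF assms(1), of x] assms(2,3) by (simp add: at_within_Icc_at)

lemma root_ode_subset:
  assumes "root_ode h a b v" "a \<le> c" "d \<le> b"
  shows "root_ode h c d v"
  using assms unfolding root_ode_def
  by (auto intro!: DERIV_subset[of v _ _ "{a..b}" "{c..d}"])

lemma root_ode_integral:
  assumes "root_ode h a b v" "x \<in> {a..b}"
  shows "v x = v a + integral {a..x} (\<lambda>s. drift (v s) + h s)"
proof -
  have "((\<lambda>s. drift (v s) + h s) has_integral v x - v a) {a..x}"
    using assms root_ode_subset[OF assms(1), of a x]
    by (intro fundamental_theorem_of_calculus)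
       (auto simp: root_ode_def has_real_derivative_iff_has_vector_derivative)
  then show ?thesis
    by (simp add: integral_unique)
qed

text \<open>Dominated convergence. An upper bound on \<open>v n\<close> gives the majorant because
  \<open>drift\<close> is nonnegative and monotone.\<close>

lemma drift_integral_limit:
  fixes a b :: real
  assumes "\<And>n. continuous_on {a..b} (v n)" "\<And>n. continuous_on {a..b} (h n)"
    and "\<And>n x. x \<in> {a..b} \<Longrightarrow> v n x \<le> K" "\<And>n x. x \<in> {a..b} \<Longrightarrow> \<bar>h n x\<bar> \<le> B"
    and "\<And>x. x \<in> {a..b} \<Longrightarrow> (\<lambda>n. v n x) \<longlonglongrightarrow> u x"
    and "\<And>x. x \<in> {a..b} \<Longrightarrow> (\<lambda>n. h n x) \<longlonglongrightarrow> k x"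
  shows "(\<lambda>s. drift (u s) + k s) integrable_on {a..b}"
    and "(\<lambda>n. integral {a..b} (\<lambda>s. drift (v n s) + h n s))
          \<longlonglongrightarrow> integral {a..b} (\<lambda>s. drift (u s) + k s)"
proof -
  have 1: "(\<lambda>s. drift (v n s) + h n s) integrable_on {a..b}" for n
    using assms(1,2) by (intro integrable_continuous_interval continuous_intros) auto
  have 2: "norm (drift (v n s) + h n s) \<le> drift K + B" if "s \<in> {a..b}" for n s
    using drift_mono[OF assms(3)[OF that, of n]] drift_nonneg[of "v n s"] assms(4)[OF that, of n]
    by auto
  have 3: "(\<lambda>n. drift (v n s) + h n s) \<longlonglongrightarrow> drift (u s) + k s" if "s \<in> {a..b}" for s
    unfolding drift_def using assms(5,6)[OF that] by (intro tendsto_intros)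
  show "(\<lambda>s. drift (u s) + k s) integrable_on {a..b}"
    and "(\<lambda>n. integral {a..b} (\<lambda>s. drift (v n s) + h n s))
          \<longlonglongrightarrow> integral {a..b} (\<lambda>s. drift (u s) + k s)"
    using dominated_convergence[of "\<lambda>n s. drift (v n s) + h n s" "{a..b}" "\<lambda>_. drift K + B"
        "\<lambda>s. drift (u s) + k s"] 1 2 3 by auto
qed

text \<open>The integral equation survives pointwise limits; it makes \<open>u\<close> continuous
  and then differentiable. The forcing may vary with \<open>n\<close>, so this serves both the
  iteration below and limits in \<open>C\<close>.\<close>

lemma root_ode_limit:
  assumes "\<And>n. continuous_on {a..b} (v n)" "\<And>n. continuous_on {a..b} (h n)"
    and k: "continuous_on {a..b} k"
    and "\<And>n x. x \<in> {a..b} \<Longrightarrow> v n x \<le> K" "\<And>n x. x \<in> {a..b} \<Longrightarrow> \<bar>h n x\<bar> \<le> B"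
    and "\<And>x. x \<in> {a..b} \<Longrightarrow> (\<lambda>n. v n x) \<longlonglongrightarrow> u x"
    and "\<And>x. x \<in> {a..b} \<Longrightarrow> (\<lambda>n. h n x) \<longlonglongrightarrow> k x"
    and u: "\<And>x. x \<in> {a..b} \<Longrightarrow>
      (\<lambda>n. y + integral {a..x} (\<lambda>s. drift (v n s) + h n s)) \<longlonglongrightarrow> u x"
  shows "root_ode k a b u"
proof -
  let ?g = "\<lambda>s. drift (u s) + k s"
  have ueq: "u x = y + integral {a..x} ?g" if x: "x \<in> {a..b}" for x
  proof (rule LIMSEQ_unique[OF u[OF x]])
    show "(\<lambda>n. y + integral {a..x} (\<lambda>s. drift (v n s) + h n s)) \<longlonglongrightarrow> y + integral {a..x} ?g"
      using x assms(3-7)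
      by (intro tendsto_intros drift_integral_limit(2)[where K = K and B = B]
          continuous_on_subset[OF assms(1)] continuous_on_subset[OF assms(2)]) auto
  qed
  have "?g integrable_on {a..b}"
    by (rule drift_integral_limit(1)[where v = v and h = h and K = K and B = B]) (use assms in auto)
  then have "continuous_on {a..b} (\<lambda>x. y + integral {a..x} ?g)"
    by (intro continuous_intros indefinite_integral_continuous_1)
  then have "continuous_on {a..b} u"
    by (rule continuous_on_eq) (simp add: ueq)
  then have g: "continuous_on {a..b} ?g"
    by (intro continuous_intros k)
  have "(u has_real_derivative ?g x) (at x within {a..b})" if x: "x \<in> {a..b}" for x
  proof -
    have "((\<lambda>x. y + integral {a..x} ?g) has_real_derivative ?g x) (at x within {a..b})"
      using integral_has_real_derivative[OF g x] by (auto intro!: derivative_eq_intros)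
    then show ?thesis
      by (rule has_field_derivative_transform_within[where d = 1]) (use x ueq in auto)
  qed
  then show ?thesis
    by (simp add: root_ode_def)
qed

text \<open>Since \<open>drift\<close> is not Lipschitz at 0, the Picard map \<open>P\<close> is
  iterated by monotonicity instead of contraction: from a constant \<open>K\<close> with
  \<open>P K \<le> K\<close> the iterates decrease and stay above \<open>- K\<close>.\<close>

lemma root_ode_exists:
  assumes "a \<le> b" and h: "continuous_on {a..b} h"
  obtains u where "u a = y" "root_ode h a b u"
proof -
  obtain B where B: "\<And>x. x \<in> {a..b} \<Longrightarrow> \<bar>h x\<bar> \<le> B"
    using compact_imp_bounded[OF compact_continuous_image[OF h]] by (force simp: bounded_iff)
  have B0: "0 \<le> B"
    using B[of a] \<open>a \<le> b\<close> by auto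
  \<comment> \<open>On constants, \<open>P K \<le> \<alpha> * sqrt K + \<beta>\<close>. With
    \<open>K\<close> the square of \<open>\<sigma> = \<alpha> + \<beta> + 1\<close> the right-hand
    side is at most \<open>K\<close>.\<close>
  define \<alpha> \<beta> where "\<alpha> = 2 * sqrt 2 * (b - a)" and "\<beta> = B * (b - a) + \<bar>y\<bar>"
  have \<alpha>\<beta>: "0 \<le> \<alpha>" "0 \<le> \<beta>"
    using \<open>a \<le> b\<close> B0 by (auto simp: \<alpha>_def \<beta>_def)
  define \<sigma> where "\<sigma> = \<alpha> + \<beta> + 1"
  define K where "K = \<sigma>\<^sup>2"
  have K0: "0 \<le> K"
    by (simp add: K_def)
  have "\<alpha> * \<sigma> + \<beta> * 1 \<le> \<alpha> * \<sigma> + \<beta> * \<sigma> + \<sigma>"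
    using \<alpha>\<beta> by (intro add_increasing2 add_mono mult_left_mono) (auto simp: \<sigma>_def)
  also have "\<dots> = K"
    by (simp add: K_def \<sigma>_def power2_eq_square algebra_simps)
  finally have K1: "\<alpha> * \<sigma> + \<beta> \<le> K"
    by simp
  have dK: "drift K * (b - a) = \<alpha> * \<sigma>"
    using \<alpha>\<beta> by (simp add: drift_def K_def \<alpha>_def \<sigma>_def)
  have "0 \<le> \<alpha> * \<sigma>"
    using \<alpha>\<beta> by (simp add: \<sigma>_def)
  with K1 have K2: "\<beta> \<le> K"
    by simp
  define P where "P = (\<lambda>v x. y + integral {a..x} (\<lambda>s. drift (v s) + h s))"
  define v where "v = (\<lambda>n. (P ^^ n) (\<lambda>_. K))"
  have v0: "v 0 = (\<lambda>_. K)" and vS: "v (Suc n) = P (v n)" for n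
    by (simp_all add: v_def)
  have int: "(\<lambda>s. drift (w s) + h s) integrable_on {a..x}"
    if "continuous_on {a..b} w" "x \<in> {a..b}" for w x
    using that by (intro integrable_continuous_interval continuous_intros)
      (auto intro: continuous_on_subset h)
  have contP: "continuous_on {a..b} (P w)" if "continuous_on {a..b} w" for w
    unfolding P_def using int[OF that, of b] \<open>a \<le> b\<close>
    by (intro continuous_intros indefinite_integral_continuous_1) auto
  have cont: "continuous_on {a..b} (v n)" for n
    by (induction n) (auto simp: v0 vS contP)
  have P_mono: "P w x \<le> P w' x"
    if "continuous_on {a..b} w" "continuous_on {a..b} w'" "x \<in> {a..b}"
      "\<And>s. s \<in> {a..b} \<Longrightarrow> w s \<le> w' s" for w w' x
    unfolding P_def using that int
    by (intro add_left_mono integral_le) (auto intro: drift_mono)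
  have Bx: "B * (x - a) \<le> B * (b - a)" if "x \<in> {a..b}" for x
    using that B0 by (intro mult_left_mono) auto
  have PK: "P (\<lambda>_. K) x \<le> K" if x: "x \<in> {a..b}" for x
  proof -
    have "integral {a..x} (\<lambda>s. drift K + h s) \<le> integral {a..x} (\<lambda>s. drift K + B)"
      using x B int[of "\<lambda>_. K"]
      by (intro integral_le) (auto simp: abs_le_iff)
    also have "\<dots> = (drift K + B) * (x - a)"
      using x by simp
    also have "\<dots> \<le> (drift K + B) * (b - a)"
      using x B0 drift_nonneg[of K] by (intro mult_left_mono) auto
    finally show ?thesis
      using K1 dK unfolding P_def \<beta>_def by (simp add: algebra_simps)
  qed
  \<comment> \<open>This bound is independent of \<open>w\<close>, because \<open>drift\<close> is
    nonnegative and may be dropped.\<close>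
  have lower: "- K \<le> P w x" if "continuous_on {a..b} w" and x: "x \<in> {a..b}" for w x
  proof -
    have "(- B) * (x - a) = integral {a..x} (\<lambda>s. - B)"
      using x by simp
    also have "\<dots> \<le> integral {a..x} (\<lambda>s. drift (w s) + h s)"
      using x B int[OF that] drift_nonneg
      by (intro integral_le) (auto simp: abs_le_iff add_increasing minus_le_iff)
    finally show ?thesis
      using K2 Bx[OF x] unfolding P_def \<beta>_def by (simp add: algebra_simps)
  qed
  have dec: "v (Suc n) x \<le> v n x" if "x \<in> {a..b}" for n x
    using that
  proof (induction n arbitrary: x)
    case 0
    then show ?case using PK by (simp add: v0 vS)
  next
    case (Suc n)
    then show ?case unfolding vS[of "Suc n"] vS[of n]
      by (intro P_mono contP cont) (auto simp flip: vS)
  qed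
  have low: "- K \<le> v n x" if "x \<in> {a..b}" for n x
    using lower[OF cont that] K0 by (cases n) (auto simp: v0 vS)
  have up: "v n x \<le> K" if "x \<in> {a..b}" for n x
    by (induction n) (use dec[OF that] in \<open>auto simp: v0 intro: order_trans\<close>)
  have "\<exists>l. (\<lambda>n. v n x) \<longlonglongrightarrow> l" if x: "x \<in> {a..b}" for x
    by (rule decseq_convergent[of "\<lambda>n. v n x" "- K"])
       (use low[OF x] dec[OF x] in \<open>auto simp: decseq_Suc_iff\<close>)
  then obtain u where u: "\<And>x. x \<in> {a..b} \<Longrightarrow> (\<lambda>n. v n x) \<longlonglongrightarrow> u x"
    by metis
  have u': "(\<lambda>n. y + integral {a..x} (\<lambda>s. drift (v n s) + h s)) \<longlonglongrightarrow> u x" if "x \<in> {a..b}" for x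
    using LIMSEQ_Suc[OF u[OF that]] by (simp add: vS P_def)
  have "u a = y"
    using LIMSEQ_unique[OF u'[of a], of y] \<open>a \<le> b\<close> by simp
  moreover have "root_ode h a b u"
    using cont h up B u u' by (intro root_ode_limit[where v = v and h = "\<lambda>_. h" and K = K and B = B and y = y]) auto
  ultimately show thesis
    using that by blast
qed

section \<open>Dependence on the parameter\<close>

text \<open>The derivative of \<open>p\<^sub>C(x)\<close> with respect to \<open>C\<close>.\<close>
definition q_poly :: "real \<Rightarrow> real \<Rightarrow> real" where
  "q_poly m x = (x - 1) * (x - m - 1) * ((m + 2) * x + m + 1) / (m + 1)^2"

text \<open>Expanding around \<open>C = 2\<close>, the value used in the later estimates, makes the
  end values and the sign of the slope in \<open>C\<close> visible.\<close>

lemma poly_p_eq: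
  assumes "0 < m"
  shows "poly_p m C x = 2 - 4 * x^2 * (x - 1) / (m * (m + 1)^2) + (C - 2) * q_poly m x"
proof -
  have "m + 1 \<noteq> 0" "m \<noteq> 0"
    using assms by auto
  then show ?thesis
    unfolding poly_p_def coeff_A_def coeff_B_def q_poly_def
    by (simp add: divide_simps) algebra
qed

lemma poly_p_ends:
  assumes "0 < m"
  shows "poly_p m C 1 = 2" "poly_p m C (m + 1) = - 2"
  using assms by (simp_all add: poly_p_eq q_poly_def)

lemma q_poly_neg: "1 < x \<Longrightarrow> x < m + 1 \<Longrightarrow> q_poly m x < 0"
  unfolding q_poly_def
  by (intro divide_neg_pos mult_neg_pos mult_pos_neg) (auto intro!: add_pos_pos)

lemma q_poly_nonpos: "x \<in> {1..m + 1} \<Longrightarrow> q_poly m x \<le> 0"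
  using q_poly_neg[of x m] by (cases "x = 1 \<or> x = m + 1") (auto simp: q_poly_def)

lemma poly_p_antimono:
  assumes "0 < m" "C1 \<le> C2" "x \<in> {1..m + 1}"
  shows "poly_p m C2 x \<le> poly_p m C1 x"
  using mult_right_mono_neg[OF _ q_poly_nonpos[OF assms(3)], of "C1 - 2" "C2 - 2"] assms
  by (simp add: poly_p_eq)

lemma poly_p_strict_antimono:
  assumes "0 < m" "C1 < C2" "1 < x" "x < m + 1"
  shows "poly_p m C2 x < poly_p m C1 x"
  using mult_strict_right_mono_neg[OF _ q_poly_neg[OF assms(3,4)], of "C1 - 2" "C2 - 2"] assms
  by (simp add: poly_p_eq)

lemma DERIV_poly_p:
  "(poly_p m C has_real_derivative x * (coeff_A m C * x + coeff_B m C)) (at x)"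
  unfolding poly_p_def[abs_def]
  by (auto intro!: derivative_eq_intros simp: power2_eq_square algebra_simps)

text \<open>
  \<open>p' = x (A x + B)\<close> has at most one sign change on \<open>x > 0\<close>, which rules out the sign pattern
  \<open>+, -, +, -\<close> at \<open>1, t, s, m + 1\<close>.
\<close>
lemma poly_p_nonneg_before:
  assumes "0 < m" "1 \<le> t" "t \<le> s" "s \<le> m + 1" "0 \<le> poly_p m C s"
  shows "0 \<le> poly_p m C t"
proof (rule ccontr)
  let ?A = "coeff_A m C" and ?B = "coeff_B m C"
  assume neg: "\<not> 0 \<le> poly_p m C t"
  have slope: "\<exists>z>a. z < b \<and> poly_p m C b - poly_p m C a = (b - a) * (z * (?A * z + ?B))"
    if "a < b" for a b
    by (rule MVT2[OF that DERIV_poly_p])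
  have "1 < t" "t < s" "s < m + 1"
    using assms neg poly_p_ends[OF assms(1), of C]
    by (auto simp: order.order_iff_strict)
  then obtain z1 z2 z3 where z: "1 < z1" "z1 < t" "t < z2" "z2 < s" "s < z3"
    and e: "poly_p m C t - poly_p m C 1 = (t - 1) * (z1 * (?A * z1 + ?B))"
      "poly_p m C s - poly_p m C t = (s - t) * (z2 * (?A * z2 + ?B))"
      "poly_p m C (m + 1) - poly_p m C s = (m + 1 - s) * (z3 * (?A * z3 + ?B))"
    using slope[of 1 t] slope[of t s] slope[of s "m + 1"] by metis
  have "(t - 1) * (z1 * (?A * z1 + ?B)) < 0"
    using e(1) neg poly_p_ends[OF assms(1), of C] by simp
  then have "?A * z1 + ?B < 0"
    using z by (auto simp: mult_less_0_iff)
  moreover have "0 < (s - t) * (z2 * (?A * z2 + ?B))"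
    using e(2) neg assms by simp
  then have "0 < ?A * z2 + ?B"
    using z by (auto simp: zero_less_mult_iff)
  moreover have "(m + 1 - s) * (z3 * (?A * z3 + ?B)) < 0"
    using e(3) assms poly_p_ends[OF assms(1), of C] by simp
  then have "?A * z3 + ?B < 0"
    using z \<open>s < m + 1\<close> by (auto simp: mult_less_0_iff)
  \<comment> \<open>The affine factor would be negative, positive, negative at
    \<open>z1 < z2 < z3\<close>, forcing both signs on \<open>?A\<close>.\<close>
  ultimately have "0 < ?A * (z2 - z1)" "?A * (z3 - z2) < 0"
    by (simp_all add: algebra_simps)
  then show False
    using z by (auto simp: mult_less_0_iff zero_less_mult_iff)
qed

section \<open>Zeros, comparison and uniqueness for the truncated initial value problem\<close>

definition ext_solution :: "real \<Rightarrow> real \<Rightarrow> real \<Rightarrow> (real \<Rightarrow> real) \<Rightarrow> bool" where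
  "ext_solution m C b v \<longleftrightarrow> v 1 = 2 \<and> root_ode (\<lambda>x. poly_p m C x * x) 1 b v"

lemma ext_solution_subset: "ext_solution m C b v \<Longrightarrow> d \<le> b \<Longrightarrow> ext_solution m C d v"
  by (auto simp: ext_solution_def intro: root_ode_subset)

lemma ext_solution_continuous_on: "ext_solution m C b v \<Longrightarrow> continuous_on {1..b} v"
  by (auto simp: ext_solution_def intro: root_ode_continuous_on)

lemma ext_solution_DERIV:
  "ext_solution m C b v \<Longrightarrow> 1 < x \<Longrightarrow> x < b \<Longrightarrow>
    (v has_real_derivative drift (v x) + poly_p m C x * x) (at x)"
  using root_ode_DERIV[of "\<lambda>x. poly_p m C x * x" 1 b v x] by (simp add: ext_solution_def)

lemma ext_solution_DERIV_within:
  "ext_solution m C b v \<Longrightarrow> x \<in> {1..b} \<Longrightarrow>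
    (v has_real_derivative drift (v x) + poly_p m C x * x) (at x within {1..b})"
  using root_odeD[of "\<lambda>x. poly_p m C x * x" 1 b v x] by (simp add: ext_solution_def)

lemma continuous_on_poly_p [continuous_intros]: "continuous_on S (poly_p m C)"
  unfolding poly_p_def[abs_def] by (intro continuous_intros) auto

text \<open>Otherwise \<open>poly_p m C\<close> is nonnegative on all of \<open>{1..t}\<close>, so
  \<open>v\<close> cannot fall below its initial value 2.\<close>

lemma poly_p_neg_at_nonpos:
  assumes "0 < m" "ext_solution m C t v" "1 \<le> t" "t \<le> m + 1" "v t \<le> 0"
  shows "poly_p m C t < 0"
proof (rule ccontr)
  assume "\<not> poly_p m C t < 0"
  then have p: "0 \<le> poly_p m C x" if "1 \<le> x" "x \<le> t" for x
    using poly_p_nonneg_before[of m x t C] that assms by simp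
  have "v 1 \<le> v t"
  proof (rule DERIV_nonneg_imp_increasing_open[where f = v])
    fix x assume "1 < x" "x < t"
    then show "\<exists>y. (v has_real_derivative y) (at x) \<and> 0 \<le> y"
      using ext_solution_DERIV[OF assms(2), of x] p[of x] drift_nonneg[of "v x"]
      by (intro exI[of _ "drift (v x) + poly_p m C x * x"]) auto
  qed (use assms ext_solution_continuous_on in auto)
  then show False
    using assms by (simp add: ext_solution_def)
qed

text \<open>From \<open>s\<close> on, \<open>poly_p m C\<close> is negative, so \<open>v\<close>
  cannot leave zero upwards; as long as \<open>v\<close> is nonpositive, \<open>drift\<close>
  vanishes and \<open>v\<close> strictly decreases.\<close>

lemma ext_solution_neg_after:
  assumes "0 < m" "ext_solution m C b v" "b \<le> m + 1" "1 \<le> s" "s < t" "t \<le> b" "v s \<le> 0"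
  shows "v t < 0"
proof -
  have cont: "continuous_on {1..b} v"
    by (rule ext_solution_continuous_on) fact
  have "poly_p m C s < 0"
    using poly_p_neg_at_nonpos[of m C s v] ext_solution_subset[OF assms(2), of s] assms by simp
  then have p: "poly_p m C x < 0" if "s \<le> x" "x \<le> b" for x
    using poly_p_nonneg_before[of m s x C] that assms by force
  have le: "v x \<le> 0" if x: "s \<le> x" "x \<le> b" for x
  proof (rule ccontr)
    assume "\<not> v x \<le> 0"
    moreover have "continuous_on {s..x} (\<lambda>x. - v x)"
      using x assms by (intro continuous_intros continuous_on_subset[OF cont]) auto
    \<comment> \<open>Applied to \<open>- v\<close>, this gives the zero \<open>r\<close> after
      which \<open>v\<close> stays positive up to \<open>x\<close>, against its negative derivative
      at \<open>r\<close>.\<close>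
    ultimately obtain r where r: "s \<le> r" "r < x" "v r = 0" "\<And>y. r < y \<Longrightarrow> y \<le> x \<Longrightarrow> 0 < v y"
      using last_crossing[of s x "\<lambda>x. - v x"] x assms by auto
    have rb: "r \<in> {1..b}"
      using r x assms by auto
    have "(v has_real_derivative poly_p m C r * r) (at r within {1..b})"
      using ext_solution_DERIV_within[OF assms(2) rb] r by (simp add: drift_nonpos)
    moreover have "poly_p m C r * r < 0"
      using p[of r] r x assms by (simp add: mult_neg_pos)
    ultimately obtain d where d: "0 < d" "\<And>h. 0 < h \<Longrightarrow> r + h \<in> {1..b} \<Longrightarrow> h < d \<Longrightarrow> v (r + h) < v r"
      using has_real_derivative_neg_dec_right by blast
    define h where "h = min (d / 2) (x - r)"
    have "0 < h" "h < d" "r + h \<le> x"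
      using d r by (auto simp: h_def)
    then show False
      using d(2)[of h] r(3) r(4)[of "r + h"] rb x by auto
  qed
  have "v t < v s"
  proof (rule DERIV_neg_imp_decreasing_open[OF \<open>s < t\<close>])
    fix x assume "s < x" "x < t"
    then show "\<exists>y. (v has_real_derivative y) (at x) \<and> y < 0"
      using ext_solution_DERIV[OF assms(2), of x] p[of x] le[of x] assms
      by (intro exI[of _ "poly_p m C x * x"]) (auto simp: drift_nonpos mult_neg_pos)
  next
    show "continuous_on {s..t} v"
      using assms by (intro continuous_on_subset[OF cont]) auto
  qed
  then show ?thesis
    using assms by simp
qed

lemma ext_solution_pos_before:
  assumes "0 < m" "ext_solution m C b v" "b \<le> m + 1" "1 \<le> s" "s \<le> t" "t \<le> b" "0 < v t"
  shows "0 < v s"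
  using ext_solution_neg_after[of m C b v s t] assms by (cases "s = t") force+

text \<open>Since \<open>comparison\<close> needs a positive lower function, the interval after the
  last crossing is treated separately: there both functions are nonpositive, the drifts vanish, and
  the difference is governed by the forcing alone.\<close>

lemma ext_solution_antimono:
  assumes m: "0 < m" and v1: "ext_solution m C1 t v1" and v2: "ext_solution m C2 t v2"
    and "C1 \<le> C2" "1 \<le> t" "t \<le> m + 1"
  shows "v2 t \<le> v1 t"
proof (rule ccontr)
  assume less: "\<not> v2 t \<le> v1 t"
  have p: "poly_p m C2 x * x \<le> poly_p m C1 x * x" if "x \<in> {1..t}" for x
    using that poly_p_antimono[of m C1 C2 x] assms by (intro mult_right_mono) auto
  have cont: "continuous_on {1..t} (\<lambda>x. v1 x - v2 x)"
    using v1 v2 by (intro continuous_intros ext_solution_continuous_on)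
  obtain s where s: "1 \<le> s" "s < t" "v1 s - v2 s = 0"
    "\<And>x. s < x \<Longrightarrow> x \<le> t \<Longrightarrow> v1 x - v2 x < 0"
    using last_crossing[OF \<open>1 \<le> t\<close> cont] less v1 v2 by (auto simp: ext_solution_def)
  \<comment> \<open>If \<open>v2 x\<close> were positive, \<open>v2\<close> would be positive on all
    of \<open>{1..x}\<close>, and \<open>comparison\<close> would contradict the crossing.\<close>
  have nonpos: "v2 x \<le> 0" if x: "s < x" "x \<le> t" for x
  proof (rule ccontr)
    assume "\<not> v2 x \<le> 0"
    then have pos: "0 < v2 y" if "y \<in> {1..x}" for y
      using ext_solution_pos_before[OF m v2, of y x] that x assms by auto
    have "v2 x \<le> v1 x"
    proof (rule comparison[where a = 1 and b = x and V = v1 and U = v2 and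
          V' = "\<lambda>y. drift (v1 y) + poly_p m C1 y * y" and
          U' = "\<lambda>y. drift (v2 y) + poly_p m C2 y * y" and h = "\<lambda>x. poly_p m C2 x * x"])
      show "(v1 has_real_derivative drift (v1 y) + poly_p m C1 y * y) (at y within {1..x})"
        "(v2 has_real_derivative drift (v2 y) + poly_p m C2 y * y) (at y within {1..x})"
        if "y \<in> {1..x}" for y
        using that ext_solution_DERIV_within ext_solution_subset v1 v2 x by blast+
    qed (use x s p pos v1 v2 in \<open>auto simp: ext_solution_def\<close>)
    then show False
      using s(4)[OF x] by simp
  qed
  have "v1 s - v2 s \<le> v1 t - v2 t"
  proof (rule DERIV_nonneg_imp_increasing_open[where f = "\<lambda>x. v1 x - v2 x"])
    fix x assume x: "s < x" "x < t"
    have "((\<lambda>x. v1 x - v2 x) has_real_derivative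
        (drift (v1 x) + poly_p m C1 x * x) - (drift (v2 x) + poly_p m C2 x * x)) (at x)"
      using x s by (intro DERIV_diff ext_solution_DERIV[OF v1] ext_solution_DERIV[OF v2]) auto
    moreover have "drift (v1 x) = 0" "drift (v2 x) = 0"
      using nonpos[of x] s(4)[of x] x by (auto intro!: drift_nonpos)
    ultimately show "\<exists>y. ((\<lambda>x. v1 x - v2 x) has_real_derivative y) (at x) \<and> 0 \<le> y"
      using p[of x] x s by (intro exI conjI) auto
  qed (use s in \<open>auto intro: continuous_on_subset[OF cont]\<close>)
  then show False
    using s(3) less by simp
qed

lemma ext_solution_unique:
  assumes "0 < m" "ext_solution m C b v" "ext_solution m C b w" "b \<le> m + 1" "t \<in> {1..b}"
  shows "v t = w t"
  using ext_solution_antimono[of m C t v C w] ext_solution_antimono[of m C t w C v]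
    ext_solution_subset[OF assms(2), of t] ext_solution_subset[OF assms(3), of t] assms
  by auto

text \<open>The choice is determined on \<open>{1..m + 1}\<close> by
  \<open>ext_solution_unique\<close>; values outside are arbitrary.\<close>

definition flow :: "real \<Rightarrow> real \<Rightarrow> real \<Rightarrow> real" where
  "flow m C = (SOME v. ext_solution m C (m + 1) v)"

lemma flow: "0 < m \<Longrightarrow> ext_solution m C (m + 1) (flow m C)"
proof -
  assume "0 < m"
  moreover have "continuous_on {1..m + 1} (\<lambda>x. poly_p m C x * x)"
    by (intro continuous_intros)
  ultimately have "\<exists>v. ext_solution m C (m + 1) v"
    using root_ode_exists[of 1 "m + 1" "\<lambda>x. poly_p m C x * x" 2] by (auto simp: ext_solution_def)
  then show ?thesis
    unfolding flow_def by (rule someI_ex)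
qed

lemma flow_antimono:
  assumes "0 < m" "C1 \<le> C2" "x \<in> {1..m + 1}"
  shows "flow m C2 x \<le> flow m C1 x"
  using ext_solution_antimono[of m C1 x "flow m C1" C2 "flow m C2"]
    ext_solution_subset[OF flow, of m x] assms by auto

lemma flow_end_strict_antimono:
  assumes m: "0 < m" and "C1 < C2"
  shows "flow m C2 (m + 1) < flow m C1 (m + 1)"
proof -
  have "flow m C1 1 - flow m C2 1 < flow m C1 (m + 1) - flow m C2 (m + 1)"
  proof (rule DERIV_pos_imp_increasing_open[where f = "\<lambda>x. flow m C1 x - flow m C2 x"])
    fix x assume x: "1 < x" "x < m + 1"
    have "((\<lambda>x. flow m C1 x - flow m C2 x) has_real_derivative
        (drift (flow m C1 x) + poly_p m C1 x * x) - (drift (flow m C2 x) + poly_p m C2 x * x)) (at x)"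
      using x by (intro DERIV_diff ext_solution_DERIV[OF flow[OF m]])
    moreover have "drift (flow m C2 x) \<le> drift (flow m C1 x)"
      using x assms by (intro drift_mono flow_antimono) auto
    moreover have "poly_p m C2 x * x < poly_p m C1 x * x"
      using poly_p_strict_antimono[OF assms x] x by simp
    ultimately show "\<exists>y. ((\<lambda>x. flow m C1 x - flow m C2 x) has_real_derivative y) (at x) \<and> 0 < y"
      by (intro exI conjI) auto
  qed (use m in \<open>auto intro!: continuous_on_diff ext_solution_continuous_on[OF flow]\<close>)
  then show ?thesis
    using flow[OF m] by (simp add: ext_solution_def)
qed

section \<open>End values\<close>

lemma continuous_on_Icc_bounded:
  fixes f :: "real \<Rightarrow> real"
  assumes "continuous_on {a..b} f"
  obtains K where "\<And>x. x \<in> {a..b} \<Longrightarrow> \<bar>f x\<bar> \<le> K"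
  using compact_imp_bounded[OF compact_continuous_image[OF assms]] by (force simp: bounded_iff)

text \<open>A monotone parameter sequence makes the flows monotone pointwise and caught between
  those at \<open>C - 1\<close> and \<open>C + 1\<close>, hence convergent; uniqueness identifies
  the limit with the flow at \<open>C\<close>.\<close>

lemma flow_end_tendsto:
  assumes m: "0 < m" and c: "monoseq c" "c \<longlonglongrightarrow> C" "\<And>n. \<bar>c n - C\<bar> \<le> 1"
  shows "(\<lambda>n. flow m (c n) (m + 1)) \<longlonglongrightarrow> flow m C (m + 1)"
proof -
  let ?I = "{1..m + 1}"
  let ?h = "\<lambda>C x. poly_p m C x * x"
  have cf: "continuous_on ?I (flow m C)" for C
    by (rule ext_solution_continuous_on[OF flow[OF m]])
  have ch: "continuous_on ?I (?h C)" for C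
    by (intro continuous_intros)
  obtain K1 K2 where K: "\<And>x. x \<in> ?I \<Longrightarrow> \<bar>flow m (C - 1) x\<bar> \<le> K1"
      "\<And>x. x \<in> ?I \<Longrightarrow> \<bar>flow m (C + 1) x\<bar> \<le> K2"
    using continuous_on_Icc_bounded[OF cf] by metis
  obtain B1 B2 where B: "\<And>x. x \<in> ?I \<Longrightarrow> \<bar>?h (C - 1) x\<bar> \<le> B1"
      "\<And>x. x \<in> ?I \<Longrightarrow> \<bar>?h (C + 1) x\<bar> \<le> B2"
    using continuous_on_Icc_bounded[OF ch] by metis
  have cn: "C - 1 \<le> c n" "c n \<le> C + 1" for n
    using c(3)[of n] by (auto simp: abs_le_iff)
  have fK: "\<bar>flow m (c n) x\<bar> \<le> max K1 K2" if x: "x \<in> ?I" for x n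
    using flow_antimono[OF m cn(1) x, of n] flow_antimono[OF m cn(2) x, of n] K[OF x] by auto
  have hB: "\<bar>?h (c n) x\<bar> \<le> max B1 B2" if x: "x \<in> ?I" for x n
  proof -
    have "?h (C + 1) x \<le> ?h (c n) x" "?h (c n) x \<le> ?h (C - 1) x"
      using x by (auto intro!: mult_right_mono poly_p_antimono[OF m] cn)
    then show ?thesis
      using B[OF x] by linarith
  qed
  have "convergent (\<lambda>n. flow m (c n) x)" if x: "x \<in> ?I" for x
  proof (rule Bseq_monoseq_convergent)
    show "Bseq (\<lambda>n. flow m (c n) x)"
      using fK[OF x] by (intro BseqI') auto
    show "monoseq (\<lambda>n. flow m (c n) x)"
      using c(1) flow_antimono[OF m _ x] by (simp add: monoseq_def) blast
  qed
  then obtain u where u: "\<And>x. x \<in> ?I \<Longrightarrow> (\<lambda>n. flow m (c n) x) \<longlonglongrightarrow> u x"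
    unfolding convergent_def by metis
  have eq: "flow m (c n) x = 2 + integral {1..x} (\<lambda>s. drift (flow m (c n) s) + ?h (c n) s)"
    if "x \<in> ?I" for x n
    using root_ode_integral[of "?h (c n)" 1 "m + 1" "flow m (c n)" x] flow[OF m, of "c n"] that
    by (simp add: ext_solution_def)
  have "root_ode (?h C) 1 (m + 1) u"
  proof (rule root_ode_limit[where v = "\<lambda>n. flow m (c n)" and h = "\<lambda>n. ?h (c n)"
        and K = "max K1 K2" and B = "max B1 B2" and y = 2])
    show "(\<lambda>n. ?h (c n) x) \<longlonglongrightarrow> ?h C x" for x
      unfolding poly_p_eq[OF m] by (intro tendsto_intros c(2))
    show "(\<lambda>n. 2 + integral {1..x} (\<lambda>s. drift (flow m (c n) s) + ?h (c n) s)) \<longlonglongrightarrow> u x"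
      if "x \<in> ?I" for x
      using u[OF that] eq[OF that] by simp
  qed (use cf ch fK hB u in \<open>auto simp: abs_le_iff\<close>)
  moreover have "u 1 = 2"
    using LIMSEQ_unique[OF u[of 1], of 2] flow[OF m] m by (simp add: ext_solution_def)
  ultimately have "ext_solution m C (m + 1) u"
    by (simp add: ext_solution_def)
  then have "u (m + 1) = flow m C (m + 1)"
    using ext_solution_unique[OF m _ flow[OF m], of C u "m + 1"] m by simp
  with u[of "m + 1"] m show ?thesis
    by simp
qed

lemma isCont_flow_end:
  assumes m: "0 < m"
  shows "isCont (\<lambda>C. flow m C (m + 1)) C"
  unfolding isCont_def
proof (rule LIM_I)
  fix e :: real assume "0 < e"
  let ?f = "\<lambda>C. flow m C (m + 1)" and ?i = "\<lambda>n. inverse (real (Suc n))"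
  have i: "?i (Suc n) \<le> ?i n" "\<bar>?i n\<bar> \<le> 1" for n
    by (auto simp: field_simps)
  have "(\<lambda>n. ?f (C - ?i n)) \<longlonglongrightarrow> ?f C"
    using tendsto_diff[OF tendsto_const LIMSEQ_inverse_real_of_nat, of C] i
    by (intro flow_end_tendsto m) (auto simp: monoseq_Suc)
  moreover have "(\<lambda>n. ?f (C + ?i n)) \<longlonglongrightarrow> ?f C"
    using tendsto_add[OF tendsto_const LIMSEQ_inverse_real_of_nat, of C] i
    by (intro flow_end_tendsto m) (auto simp: monoseq_Suc)
  ultimately have "\<forall>\<^sub>F n in sequentially. dist (?f (C - ?i n)) (?f C) < e \<and> dist (?f (C + ?i n)) (?f C) < e"
    using \<open>0 < e\<close> by (intro eventually_conj tendstoD)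
  then obtain n where n: "\<bar>?f (C - ?i n) - ?f C\<bar> < e" "\<bar>?f (C + ?i n) - ?f C\<bar> < e"
    by (auto simp: eventually_sequentially dist_real_def)
  \<comment> \<open>Monotonicity in the parameter extends the estimate from \<open>C - ?i n\<close>
    and \<open>C + ?i n\<close> to everything in between.\<close>
  have "\<bar>?f C' - ?f C\<bar> < e" if "\<bar>C' - C\<bar> < ?i n" for C'
    using flow_antimono[of m "C - ?i n" C' "m + 1"] flow_antimono[of m C' "C + ?i n" "m + 1"] n that m
    by (auto simp: abs_less_iff)
  then show "\<exists>s>0. \<forall>x. x \<noteq> C \<and> norm (x - C) < s \<longrightarrow> norm (?f x - ?f C) < e"
    by (intro exI[of _ "?i n"]) auto
qed

section \<open>The primitive of \<open>poly_p m C x * x\<close> vanishing at 1, and the end-value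
  bounds it yields\<close>

definition primitive :: "real \<Rightarrow> real \<Rightarrow> real \<Rightarrow> real" where
  "primitive m C x = x^2 - 1 - (4 * x^5 - 5 * x^4 + 1) / (5 * m * (m + 1)^2) +
     (C - 2) * (((m + 2) * (x^5 - 1) / 5 + (m + 1 - (m + 2)^2) * (x^4 - 1) / 4) / (m + 1)^2
       + (x^2 - 1) / 2)"

lemma DERIV_primitive:
  assumes "0 < m"
  shows "(primitive m C has_real_derivative poly_p m C x * x) (at x)"
proof -
  have "m + 1 \<noteq> 0" "m \<noteq> 0"
    using assms by auto
  then show ?thesis
    unfolding primitive_def[abs_def] poly_p_eq[OF assms] q_poly_def
    by (auto intro!: derivative_eq_intros simp: divide_simps) algebra
qed

text \<open>Isolates the affine dependence on \<open>C\<close>; its negative slope drives the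
  behaviour of the end value for large \<open>C\<close> of either sign.\<close>

lemma primitive_end:
  assumes "0 < m"
  shows "primitive m C (m + 1) = primitive m 2 (m + 1) -
    (C - 2) * (m^3 * (m + 2) * (m^2 + 5 * m + 5) / (20 * (m + 1)^2))"
proof -
  have "m + 1 \<noteq> 0"
    using assms by auto
  then have "((m + 2) * ((m + 1)^5 - 1) / 5 + (m + 1 - (m + 2)^2) * ((m + 1)^4 - 1) / 4) / (m + 1)^2
       + ((m + 1)^2 - 1) / 2 = - (m^3 * (m + 2) * (m^2 + 5 * m + 5) / (20 * (m + 1)^2))"
    by (simp add: divide_simps) algebra
  then show ?thesis
    unfolding primitive_def by simp
qed

text \<open>The numerator factors as \<open>4 * x^5 - 5 * x^4 + 1 = (x - 1)^2 * R\<close>; one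
  factor \<open>x - 1\<close> is bounded by \<open>m\<close>, and \<open>R\<close> by
  \<open>5 * (x + 1) * (m + 1)^2\<close>.\<close>

lemma primitive_2_pos:
  assumes m: "0 < m" and x: "1 < x" "x \<le> m + 1"
  shows "0 < primitive m 2 x"
proof -
  define R where "R = 4 * x^3 + 3 * x^2 + 2 * x + 1"
  have R0: "0 < R"
    using x by (auto simp: R_def intro!: add_pos_pos)
  \<comment> \<open>This product is \<open>(x + 1) * (5 * x^2) - R\<close>.\<close>
  have "0 < (x - 1) * (x^2 + 3 * x + 1)"
    using x by (intro mult_pos_pos add_pos_pos) auto
  then have "R < (x + 1) * (5 * x^2)"
    by (simp add: R_def power2_eq_square power3_eq_cube algebra_simps)
  also have "\<dots> \<le> (x + 1) * (5 * (m + 1)^2)"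
    using x by (intro mult_left_mono power_mono) auto
  finally have R: "R < (x + 1) * (5 * (m + 1)^2)" .
  have "4 * x^5 - 5 * x^4 + 1 = (x - 1) * R * (x - 1)"
    unfolding R_def by algebra
  also have "\<dots> \<le> (x - 1) * R * m"
    using x R0 by (intro mult_left_mono) auto
  also have "\<dots> < (x - 1) * ((x + 1) * (5 * (m + 1)^2)) * m"
    using R x m by (intro mult_strict_right_mono mult_strict_left_mono) auto
  also have "\<dots> = (x^2 - 1) * (5 * m * (m + 1)^2)"
    by algebra
  finally show ?thesis
    using m by (simp add: primitive_def pos_divide_less_eq)
qed

text \<open>Discarding the nonnegative \<open>drift\<close> leaves exactly the derivative of
  \<open>primitive\<close>.\<close>

lemma flow_end_ge:
  assumes m: "0 < m"
  shows "2 + primitive m C (m + 1) \<le> flow m C (m + 1)"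
proof -
  have "flow m C 1 - primitive m C 1 \<le> flow m C (m + 1) - primitive m C (m + 1)"
  proof (rule DERIV_nonneg_imp_increasing_open[where f = "\<lambda>x. flow m C x - primitive m C x"])
    fix x assume x: "1 < x" "x < m + 1"
    have "((\<lambda>x. flow m C x - primitive m C x) has_real_derivative
        (drift (flow m C x) + poly_p m C x * x) - poly_p m C x * x) (at x)"
      using x by (intro DERIV_diff ext_solution_DERIV[OF flow[OF m]] DERIV_primitive[OF m])
    then show "\<exists>y. ((\<lambda>x. flow m C x - primitive m C x) has_real_derivative y) (at x) \<and> 0 \<le> y"
      using drift_nonneg[of "flow m C x"] by (intro exI conjI) auto
  next
    show "continuous_on {1..m + 1} (\<lambda>x. flow m C x - primitive m C x)"
      using DERIV_primitive[OF m]
      by (intro continuous_on_diff ext_solution_continuous_on[OF flow[OF m]] DERIV_continuous_on)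
        (blast intro: has_field_derivative_at_within)
  qed (use m in auto)
  then show ?thesis
    using flow[OF m, of C] by (simp add: ext_solution_def primitive_def)
qed

lemma flow_end_le:
  assumes m: "0 < m" and K: "\<And>x. x \<in> {1..m + 1} \<Longrightarrow> flow m C x \<le> K"
  shows "flow m C (m + 1) \<le> 2 + drift K * m + primitive m C (m + 1)"
proof -
  let ?g = "\<lambda>x. drift K * x + primitive m C x - flow m C x"
  have "?g 1 \<le> ?g (m + 1)"
  proof (rule DERIV_nonneg_imp_increasing_open[where f = ?g])
    fix x assume x: "1 < x" "x < m + 1"
    have "(?g has_real_derivative
        drift K * 1 + poly_p m C x * x - (drift (flow m C x) + poly_p m C x * x)) (at x)"
      using x by (intro DERIV_diff DERIV_add DERIV_cmult DERIV_ident
          ext_solution_DERIV[OF flow[OF m]] DERIV_primitive[OF m])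
    then show "\<exists>y. (?g has_real_derivative y) (at x) \<and> 0 \<le> y"
      using drift_mono[OF K[of x]] x by (intro exI conjI) auto
  next
    show "continuous_on {1..m + 1} ?g"
      using DERIV_primitive[OF m]
      by (intro continuous_intros ext_solution_continuous_on[OF flow[OF m]] DERIV_continuous_on)
        (blast intro: has_field_derivative_at_within)
  qed (use m in auto)
  then show ?thesis
    using flow[OF m, of C] by (simp add: ext_solution_def primitive_def algebra_simps)
qed

lemma flow_end_at_bot:
  assumes m: "0 < m"
  shows "filterlim (\<lambda>C. flow m C (m + 1)) at_top at_bot"
  unfolding filterlim_at_top eventually_at_bot_linorder
proof (intro allI exI impI)
  fix Z C
  define b where "b = m^3 * (m + 2) * (m^2 + 5 * m + 5) / (20 * (m + 1)^2)"
  have b: "0 < b"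
    using m unfolding b_def by (intro divide_pos_pos mult_pos_pos) (auto intro!: add_pos_pos)
  \<comment> \<open>The bound comes from solving \<open>Z \<le> 2 + primitive m C (m + 1)\<close>
    for \<open>C\<close>.\<close>
  assume "C \<le> 2 - (Z - 2 - primitive m 2 (m + 1)) / b"
  then have "(Z - 2 - primitive m 2 (m + 1)) / b \<le> 2 - C"
    by simp
  then have "(Z - 2 - primitive m 2 (m + 1)) \<le> (2 - C) * b"
    using b by (simp only: pos_divide_le_eq)
  then have "Z \<le> 2 + (primitive m 2 (m + 1) - (C - 2) * b)"
    by (simp add: algebra_simps)
  also have "\<dots> = 2 + primitive m C (m + 1)"
    using primitive_end[OF m, of C] by (simp add: b_def)
  also have "\<dots> \<le> flow m C (m + 1)"
    by (rule flow_end_ge[OF m])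
  finally show "Z \<le> flow m C (m + 1)" .
qed

lemma flow_end_neg:
  assumes m: "0 < m"
  obtains C where "2 < C" "flow m C (m + 1) < 0"
proof -
  define b where "b = m^3 * (m + 2) * (m^2 + 5 * m + 5) / (20 * (m + 1)^2)"
  have b: "0 < b"
    using m unfolding b_def by (intro divide_pos_pos mult_pos_pos) (auto intro!: add_pos_pos)
  obtain K where K: "\<And>x. x \<in> {1..m + 1} \<Longrightarrow> \<bar>flow m 2 x\<bar> \<le> K"
    using continuous_on_Icc_bounded[OF ext_solution_continuous_on[OF flow[OF m]]] by metis
  define Z where "Z = 2 + drift K * m + primitive m 2 (m + 1)"
  \<comment> \<open>Chosen so that \<open>(C - 2) * b = \<bar>Z\<bar> + 1\<close> exceeds
    \<open>Z\<close>. The constant \<open>K\<close> from the flow at 2 still applies, since the flow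
    at \<open>C\<close> lies below it.\<close>
  define C where "C = 2 + (\<bar>Z\<bar> + 1) / b"
  have C: "2 < C"
    using b by (simp add: C_def)
  have "flow m C x \<le> K" if x: "x \<in> {1..m + 1}" for x
    using flow_antimono[OF m _ x, of 2 C] K[OF x] C by simp
  then have "flow m C (m + 1) \<le> 2 + drift K * m + primitive m C (m + 1)"
    by (rule flow_end_le[OF m])
  also have "\<dots> = Z - (C - 2) * b"
    using primitive_end[OF m, of C] by (simp add: Z_def b_def)
  also have "\<dots> = Z - (\<bar>Z\<bar> + 1)"
    using b by (simp add: C_def)
  also have "\<dots> < 0"
    by simp
  finally show thesis
    using that C by blast
qed

text \<open>The function \<open>2 * x^2\<close> solves the unforced equation with value 2 at 1.
  Adding the nonnegative primitive only increases \<open>drift\<close>, so the sum is a subsolution;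
  the primitive is positive at \<open>m + 1\<close>, which gives strictness.\<close>

lemma flow_2_end:
  assumes m: "0 < m"
  shows "2 * (m + 1)^2 < flow m 2 (m + 1)"
proof -
  let ?U = "\<lambda>x. 2 * x^2 + primitive m 2 x"
  have prim: "0 \<le> primitive m 2 x" if "x \<in> {1..m + 1}" for x
    using primitive_2_pos[OF m, of x] that by (cases "x = 1") (auto simp: primitive_def)
  have "?U (m + 1) \<le> flow m 2 (m + 1)"
  proof (rule comparison[where a = 1 and h = "\<lambda>x. poly_p m 2 x * x" and V = "flow m 2" and U = ?U
        and V' = "\<lambda>x. drift (flow m 2 x) + poly_p m 2 x * x"
        and U' = "\<lambda>x. 4 * x + poly_p m 2 x * x"])
    fix x assume x: "x \<in> {1..m + 1}"
    show "(?U has_real_derivative 4 * x + poly_p m 2 x * x) (at x within {1..m + 1})"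
      by (rule has_field_derivative_at_within)
        (auto intro!: derivative_eq_intros DERIV_primitive[OF m])
    show "(flow m 2 has_real_derivative drift (flow m 2 x) + poly_p m 2 x * x) (at x within {1..m + 1})"
      by (rule ext_solution_DERIV_within[OF flow[OF m] x])
    have "4 * x = drift (2 * x^2)"
      using x by (simp add: drift_def real_sqrt_mult)
    also have "\<dots> \<le> drift (?U x)"
      using prim[OF x] by (intro drift_mono) simp
    finally show "4 * x + poly_p m 2 x * x \<le> drift (?U x) + poly_p m 2 x * x"
      by simp
    show "0 < ?U x"
      using prim[OF x] x by (intro add_pos_nonneg) auto
  qed (use m flow[OF m, of 2] in \<open>auto simp: ext_solution_def primitive_def\<close>)
  then show ?thesis
    using primitive_2_pos[OF m, of "m + 1"] m by simp
qed

section \<open>Smoothness and the threshold\<close>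

text \<open>Iterating a choice of derivative inside \<open>F\<close> produces the whole sequence of
  derivatives.\<close>

lemma smooth_on_interval_family:
  assumes "f \<in> F"
    and "\<And>g. g \<in> F \<Longrightarrow> \<exists>g'\<in>F. \<forall>x\<in>I. (g has_real_derivative g' x) (at x within I)"
  shows "smooth_on_interval f I"
proof -
  obtain d where d: "\<And>g. g \<in> F \<Longrightarrow> d g \<in> F"
    "\<And>g x. g \<in> F \<Longrightarrow> x \<in> I \<Longrightarrow> (g has_real_derivative d g x) (at x within I)"
    using assms(2) by metis
  have "(d ^^ n) f \<in> F" for n
    by (induction n) (auto intro: assms d)
  then show ?thesis
    unfolding smooth_on_interval_def
    by (intro exI[of _ "\<lambda>n. (d ^^ n) f"]) (auto intro: d)
qed

lemma smooth_on_interval_cong: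
  assumes "smooth_on_interval f I" "\<And>x. x \<in> I \<Longrightarrow> f x = g x"
  shows "smooth_on_interval g I"
  using assms unfolding smooth_on_interval_def by auto

text \<open>
  For \<open>u = sqrt v\<close> the equation reads \<open>u' = sqrt 2 + x p\<^sub>C(x) / (2 u)\<close>, so this algebra is closed
  under differentiation.
\<close>
inductive_set laurent_terms :: "(real \<Rightarrow> real) \<Rightarrow> (real \<Rightarrow> real) set" for u where
  const: "(\<lambda>_. c) \<in> laurent_terms u"
| ident: "(\<lambda>x. x) \<in> laurent_terms u"
| root: "u \<in> laurent_terms u"
| recip: "(\<lambda>x. 1 / u x) \<in> laurent_terms u"
| add: "f \<in> laurent_terms u \<Longrightarrow> g \<in> laurent_terms u \<Longrightarrow> (\<lambda>x. f x + g x) \<in> laurent_terms u"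
| mult: "f \<in> laurent_terms u \<Longrightarrow> g \<in> laurent_terms u \<Longrightarrow> (\<lambda>x. f x * g x) \<in> laurent_terms u"

lemma laurent_terms_power: "f \<in> laurent_terms u \<Longrightarrow> (\<lambda>x. f x ^ n) \<in> laurent_terms u"
  by (induction n) (auto intro: laurent_terms.intros)

lemma laurent_terms_DERIV:
  assumes u: "\<And>x. x \<in> I \<Longrightarrow> 0 < u x" "u' \<in> laurent_terms u"
      "\<And>x. x \<in> I \<Longrightarrow> (u has_real_derivative u' x) (at x within I)"
    and "g \<in> laurent_terms u"
  shows "\<exists>g'\<in>laurent_terms u. \<forall>x\<in>I. (g has_real_derivative g' x) (at x within I)"
  using assms(4)
proof induction
  case (const c)
  show ?case
    by (intro bexI[of _ "\<lambda>_. 0"] laurent_terms.const) auto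
next
  case ident
  show ?case
    by (intro bexI[of _ "\<lambda>_. 1"] laurent_terms.const) auto
next
  case root
  show ?case
    using u by blast
next
  case recip
  show ?case
  proof (intro bexI ballI)
    show "(\<lambda>x. (- 1) * (u' x * ((1 / u x) * (1 / u x)))) \<in> laurent_terms u"
      by (intro laurent_terms.intros u)
    show "((\<lambda>x. 1 / u x) has_real_derivative (- 1) * (u' x * ((1 / u x) * (1 / u x)))) (at x within I)"
      if "x \<in> I" for x
      using u(1,3)[OF that] by (auto intro!: derivative_eq_intros simp: field_simps)
  qed
next
  case (add f g)
  then obtain f' g' where "f' \<in> laurent_terms u" "g' \<in> laurent_terms u"
    "\<forall>x\<in>I. (f has_real_derivative f' x) (at x within I)"
    "\<forall>x\<in>I. (g has_real_derivative g' x) (at x within I)"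
    by blast
  then show ?case
    by (intro bexI[of _ "\<lambda>x. f' x + g' x"] laurent_terms.add) (auto intro: DERIV_add)
next
  case (mult f g)
  then obtain f' g' where "f' \<in> laurent_terms u" "g' \<in> laurent_terms u"
    "\<forall>x\<in>I. (f has_real_derivative f' x) (at x within I)"
    "\<forall>x\<in>I. (g has_real_derivative g' x) (at x within I)"
    by blast
  with mult.hyps show ?case
    by (intro bexI[of _ "\<lambda>x. f' x * g x + g' x * f x"] laurent_terms.add laurent_terms.mult)
      (auto intro: DERIV_mult)
qed

lemma poly_p_laurent_terms: "(\<lambda>x. poly_p m C x * x) \<in> laurent_terms u"
proof -
  have "(\<lambda>x. (coeff_A m C / 3 * x^3 + coeff_B m C / 2 * x^2 + C) * x) \<in> laurent_terms u"
    by (intro laurent_terms.intros laurent_terms_power)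
  then show ?thesis
    by (simp add: poly_p_def)
qed

text \<open>Where \<open>v\<close> is positive it equals \<open>u * u\<close> with
  \<open>u = sqrt v\<close>, an element of the differentiation-closed algebra generated from
  \<open>u\<close>.\<close>

lemma ext_solution_smooth:
  assumes v: "ext_solution m C b v" and I: "I \<subseteq> {1..b}" and pos: "\<And>x. x \<in> I \<Longrightarrow> 0 < v x"
  shows "smooth_on_interval v I"
proof -
  define u where "u = (\<lambda>x. sqrt (v x))"
  have "smooth_on_interval (\<lambda>x. u x * u x) I"
  proof (rule smooth_on_interval_family[where F = "laurent_terms u"])
    show "(\<lambda>x. u x * u x) \<in> laurent_terms u"
      by (intro laurent_terms.intros)
    show "\<exists>g'\<in>laurent_terms u. \<forall>x\<in>I. (g has_real_derivative g' x) (at x within I)"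
      if "g \<in> laurent_terms u" for g
    proof (rule laurent_terms_DERIV[OF _ _ _ that])
      show "0 < u x" if "x \<in> I" for x
        using pos[OF that] by (simp add: u_def)
      show "(\<lambda>x. sqrt 2 + (1 / 2) * ((poly_p m C x * x) * (1 / u x))) \<in> laurent_terms u"
        by (intro laurent_terms.intros poly_p_laurent_terms)
      show "(u has_real_derivative sqrt 2 + (1 / 2) * ((poly_p m C x * x) * (1 / u x))) (at x within I)"
        if x: "x \<in> I" for x
      proof -
        have "(v has_real_derivative 2 * sqrt 2 * sqrt (v x) + poly_p m C x * x) (at x within I)"
          using DERIV_subset[OF ext_solution_DERIV_within[OF v, of x] I] I x pos[OF x]
          by (auto simp: drift_eq)
        then show ?thesis
          unfolding u_def using pos[OF x]
          by (auto intro!: derivative_eq_intros simp: field_simps)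
      qed
    qed
  qed
  then show ?thesis
    by (rule smooth_on_interval_cong) (use pos in \<open>force simp: u_def\<close>)
qed

section \<open>Solutions of the original problem as restrictions of the flow\<close>

lemma ivp_solution_flow:
  assumes m: "0 < m" and I: "is_interval I" "1 \<in> I" "I \<subseteq> {1..m + 1}"
    and pos: "\<And>x. x \<in> I \<Longrightarrow> 0 < flow m C x"
  shows "ivp_solution m C I (restrict (flow m C) I)"
proof -
  have "smooth_on_interval (restrict (flow m C) I) I"
    by (rule smooth_on_interval_cong[OF ext_solution_smooth[OF flow[OF m] I(3) pos]]) auto
  moreover have "(restrict (flow m C) I has_real_derivative
      2 * sqrt 2 * sqrt (restrict (flow m C) I x) + poly_p m C x * x) (at x within I)" if x: "x \<in> I" for x
  proof (rule has_field_derivative_transform_within[where d = 1 and f = "flow m C"])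
    show "(flow m C has_real_derivative
      2 * sqrt 2 * sqrt (restrict (flow m C) I x) + poly_p m C x * x) (at x within I)"
      using DERIV_subset[OF ext_solution_DERIV_within[OF flow[OF m], of x C] I(3)] subsetD[OF I(3) x]
        x pos[OF x] by (simp add: drift_eq)
  qed (use x in auto)
  ultimately show ?thesis
    using I pos flow[OF m, of C] by (auto simp: ivp_solution_def ext_solution_def less_imp_le)
qed

lemma ivp_solution_ext_solution:
  assumes v: "ivp_solution m C I v" and "t \<in> I"
  shows "ext_solution m C t v"
proof -
  have "{1..t} \<subseteq> I"
    using assms unfolding ivp_solution_def is_interval_1 by (metis atLeastAtMost_iff subsetI)
  moreover have "(v has_real_derivative drift (v x) + poly_p m C x * x) (at x within {1..t})"
    if "x \<in> {1..t}" for x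
    using v \<open>{1..t} \<subseteq> I\<close> that
    by (intro DERIV_subset[OF _ \<open>{1..t} \<subseteq> I\<close>]) (auto simp: ivp_solution_def drift_eq)
  ultimately show ?thesis
    using v by (simp add: ivp_solution_def ext_solution_def root_ode_def)
qed

lemma ivp_solution_eq_flow:
  assumes "0 < m" "ivp_solution m C I v" "x \<in> I"
  shows "v x = flow m C x"
proof -
  have x: "1 \<le> x" "x \<le> m + 1"
    using assms(2,3) by (auto simp: ivp_solution_def)
  then show ?thesis
    using ext_solution_unique[OF assms(1) ivp_solution_ext_solution[OF assms(2,3)]
        ext_solution_subset[OF flow[OF assms(1)], of x]] by auto
qed

lemma ivp_solution_eq_restrict:
  assumes "0 < m" "ivp_solution m C I v"
  shows "v = restrict (flow m C) I"
proof (rule extensionalityI)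
  show "v \<in> extensional I"
    using assms(2) by (simp add: ivp_solution_def)
qed (use ivp_solution_eq_flow[OF assms] in auto)

lemma has_real_derivative_unique_Icc:
  fixes f :: "real \<Rightarrow> real"
  assumes "a < b" "x \<in> {a..b}" "(f has_real_derivative d) (at x within {a..b})"
    "(f has_real_derivative e) (at x within {a..b})"
  shows "d = e"
  using assms vector_derivative_unique_within_closed_interval[of a b x f d e]
  by (simp add: has_real_derivative_iff_has_vector_derivative)

lemma ivp_solution_nonzero:
  assumes m: "0 < m" and w: "ivp_solution m C J w" and r: "1 < r" "{1..r} \<subseteq> J"
  shows "flow m C r \<noteq> 0"
proof
  assume zero: "flow m C r = 0"
  obtain D where D: "\<And>x. x \<in> J \<Longrightarrow> D 0 x = w x"
      "\<And>n x. x \<in> J \<Longrightarrow> (D n has_real_derivative D (Suc n) x) (at x within J)"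
    using w unfolding ivp_solution_def smooth_on_interval_def by blast
  have rJ: "r \<in> J"
    using r by auto
  then have rm: "r \<le> m + 1"
    using w by (auto simp: ivp_solution_def)
  have w0: "w r = 0"
    using ivp_solution_eq_flow[OF m w rJ] zero by simp
  have w': "(w has_real_derivative 2 * sqrt 2 * sqrt (w x) + poly_p m C x * x) (at x within {1..r})"
    if "x \<in> {1..r}" for x
    using w subsetD[OF r(2) that] by (intro DERIV_subset[OF _ r(2)]) (auto simp: ivp_solution_def)
  \<comment> \<open>The sequence \<open>D\<close> is differentiated within \<open>J\<close>; on the
    nondegenerate interval \<open>{1..r}\<close> derivatives are unique, which identifies
    \<open>D 1\<close> with the right-hand side.\<close>
  have D1: "D 1 x = 2 * sqrt 2 * sqrt (w x) + poly_p m C x * x" if x: "x \<in> {1..r}" for x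
  proof -
    have "(D 0 has_real_derivative D 1 x) (at x within {1..r})"
      using DERIV_subset[OF D(2)[of x 0] r(2)] x r by auto
    then have "(w has_real_derivative D 1 x) (at x within {1..r})"
      by (rule has_field_derivative_transform_within[where d = 1]) (use x r D(1) in auto)
    then show ?thesis
      using has_real_derivative_unique_Icc[OF r(1) x _ w'[OF x]] by simp
  qed
  \<comment> \<open>Solving the equation for the square root shows it differentiable at
    \<open>r\<close>, because \<open>D 1\<close> is. The product rule for \<open>g * g\<close> then
    gives \<open>w\<close> derivative 0 at \<open>r\<close>.\<close>
  define g where "g = (\<lambda>x. (D 1 x - poly_p m C x * x) / (2 * sqrt 2))"
  have g: "g x = sqrt (w x)" if "x \<in> {1..r}" for x
    using D1[OF that] by (simp add: g_def)
  have "(D 1 has_real_derivative D 2 r) (at r within {1..r})"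
    using DERIV_subset[OF D(2)[OF rJ, of 1] r(2)] by (simp add: numeral_2_eq_2)
  moreover have "((\<lambda>x. poly_p m C x * x) has_real_derivative
      poly_p m C r * 1 + (r * (coeff_A m C * r + coeff_B m C)) * r) (at r within {1..r})"
    by (rule has_field_derivative_at_within) (auto intro!: derivative_eq_intros DERIV_poly_p)
  ultimately obtain e where e: "(g has_real_derivative e) (at r within {1..r})"
    unfolding g_def using DERIV_cdivide DERIV_diff by blast
  have "((\<lambda>x. g x * g x) has_real_derivative e * g r + e * g r) (at r within {1..r})"
    by (rule DERIV_mult[OF e e])
  then have "(w has_real_derivative e * g r + e * g r) (at r within {1..r})"
    by (rule has_field_derivative_transform_within[where d = 1])
      (use r g w in \<open>auto simp: ivp_solution_def\<close>)
  then have "poly_p m C r * r = 0"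
    using has_real_derivative_unique_Icc[OF r(1) _ _ w'[of r]] r g[of r] w0 by simp
  moreover have "poly_p m C r < 0"
    using poly_p_neg_at_nonpos[OF m ivp_solution_ext_solution[OF w rJ]] r rm w0 by simp
  ultimately show False
    using r by simp
qed

section \<open>Full solutions, maximal solutions and the threshold\<close>

lemma full_solution_eq:
  assumes m: "0 < m" and C: "0 < flow m C (m + 1)"
  shows "\<exists>!v. ivp_solution m C {1..m + 1} v" "full_solution m C (m + 1) = flow m C (m + 1)"
proof -
  have "ivp_solution m C {1..m + 1} (restrict (flow m C) {1..m + 1})"
    using m ext_solution_pos_before[OF m flow[OF m] _ _ _ _ C]
    by (intro ivp_solution_flow m) (auto simp: is_interval_cc)
  with ivp_solution_eq_restrict[OF m] show u: "\<exists>!v. ivp_solution m C {1..m + 1} v"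
    by metis
  show "full_solution m C (m + 1) = flow m C (m + 1)"
    using ivp_solution_eq_flow[OF m theI'[OF u], of "m + 1"] m by (simp add: full_solution_def)
qed

lemma flow_end_less_iff:
  assumes "0 < m"
  shows "flow m C1 (m + 1) < flow m C2 (m + 1) \<longleftrightarrow> C2 < C1"
  using flow_end_strict_antimono[OF assms, of C1 C2] flow_end_strict_antimono[OF assms, of C2 C1]
  by (cases C1 C2 rule: linorder_cases) auto

text \<open>Here \<open>r\<close> is the zero of the flow. A solution stopping earlier extends to
  its closed interval, where the flow is still positive; one reaching further would have to follow
  the flow into negative values.\<close>

lemma flow_maximal:
  assumes m: "0 < m" and C: "flow m C (m + 1) \<le> 0"
  obtains r where "r \<in> {1<..m + 1}" "maximal_solution m C r (restrict (flow m C) {1..<r})"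
    "\<And>r' w. r' \<in> {1<..m + 1} \<Longrightarrow> maximal_solution m C r' w \<Longrightarrow> r' = r"
proof -
  have f1: "flow m C 1 = 2"
    using flow[OF m, of C] by (simp add: ext_solution_def)
  have "\<exists>r\<ge>1. r \<le> m + 1 \<and> flow m C r = 0"
    using m C f1 by (intro IVT2' ext_solution_continuous_on[OF flow[OF m]]) auto
  then obtain r where r: "1 \<le> r" "r \<le> m + 1" "flow m C r = 0"
    by blast
  with f1 have r1: "1 < r"
    by (cases "r = 1") auto
  have pos: "0 < flow m C x" if "1 \<le> x" "x < r" for x
    using ext_solution_neg_after[OF m flow[OF m], of x r C] that r by force
  have "ivp_solution m C {1..<r} (restrict (flow m C) {1..<r})"
    using r r1 pos by (intro ivp_solution_flow m) (auto simp: is_interval_co)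
  moreover have "\<not> continuable_beyond m C r v" for v
    using ivp_solution_nonzero[OF m _ r1] r(3) unfolding continuable_beyond_def by blast
  ultimately have max: "maximal_solution m C r (restrict (flow m C) {1..<r})"
    by (simp add: maximal_solution_def)
  have "r' = r" if r': "r' \<in> {1<..m + 1}" and w: "maximal_solution m C r' w" for r' w
  proof (rule ccontr)
    assume "r' \<noteq> r"
    have sol: "ivp_solution m C {1..<r'} w" and nc: "\<not> continuable_beyond m C r' w"
      using w by (auto simp: maximal_solution_def)
    have w_eq: "w x = flow m C x" if "x \<in> {1..<r'}" for x
      using ivp_solution_eq_flow[OF m sol that] .
    show False
    proof (cases "r' < r")
      case True
      have "ivp_solution m C {1..r'} (restrict (flow m C) {1..r'})"
        using r' r pos True by (intro ivp_solution_flow m) (auto simp: is_interval_cc)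
      then show False
        using nc w_eq unfolding continuable_beyond_def by force
    next
      case False
      define x where "x = (r + r') / 2"
      have x: "r < x" "x < r'"
        using False \<open>r' \<noteq> r\<close> by (auto simp: x_def)
      have "flow m C x < 0"
        using ext_solution_neg_after[OF m flow[OF m], of r x C] x r r' by simp
      moreover have "0 \<le> w x"
        using sol x r by (auto simp: ivp_solution_def)
      ultimately show False
        using w_eq[of x] x r by simp
    qed
  qed
  moreover have "r \<in> {1<..m + 1}"
    using r r1 by simp
  ultimately show thesis
    using that max by blast
qed

text \<open>Turns uniqueness of the threshold into injectivity of the end value. Conversely, a
  negative end value at \<open>M\<close> persists for some \<open>C < M\<close>, where a nonnegative
  full solution is demanded; a positive one gives a full solution at \<open>M\<close> continuing the
  allegedly maximal one.\<close>

lemma is_threshold_iff: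
  assumes m: "0 < m"
  shows "is_threshold m M \<longleftrightarrow> flow m M (m + 1) = 0"
proof -
  let ?f = "\<lambda>C. flow m C (m + 1)"
  have thr: "is_threshold m M" if M: "?f M = 0" for M
  proof -
    have pos: "0 < ?f C" if "C < M" for C
      using flow_end_less_iff[OF m, of M C] that M by simp
    have eq: "full_solution m C (m + 1) = ?f C" if "C < M" for C
      using full_solution_eq(2)[OF m pos[OF that]] .
    \<comment> \<open>Below \<open>M\<close> the description operator in
      \<open>full_solution\<close> is well defined, so both limits are transferred along eventual
      equality.\<close>
    have "\<forall>\<^sub>F C in at_bot. full_solution m C (m + 1) = ?f C"
      using eventually_mono[OF eventually_gt_at_bot[of M] eq] .
    then have "filterlim (\<lambda>C. full_solution m C (m + 1)) at_top at_bot"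
      using flow_end_at_bot[OF m] by (simp cong: filterlim_cong)
    moreover have "((\<lambda>C. full_solution m C (m + 1)) \<longlongrightarrow> 0) (at_left M)"
    proof (rule Lim_transform_eventually)
      show "(?f \<longlongrightarrow> 0) (at_left M)"
        using isCont_flow_end[OF m, of M] M
        by (simp add: isCont_def Lim_at_imp_Lim_at_within)
      show "\<forall>\<^sub>F C in at_left M. ?f C = full_solution m C (m + 1)"
        using eq by (auto simp: eventually_at_filter)
    qed
    moreover have "\<exists>r v. r \<in> {1<..m + 1} \<and> maximal_solution m C r v \<and>
        (\<forall>w. ivp_solution m C {1..<r} w \<longrightarrow> w = v) \<and>
        (\<forall>r' w. r' \<in> {1<..m + 1} \<and> maximal_solution m C r' w \<longrightarrow> r' = r)" if "M \<le> C" for C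
    proof -
      have "?f C \<le> 0"
        using flow_antimono[OF m that, of "m + 1"] M m by simp
      then obtain r where "r \<in> {1<..m + 1}" "maximal_solution m C r (restrict (flow m C) {1..<r})"
        "\<And>r' w. r' \<in> {1<..m + 1} \<Longrightarrow> maximal_solution m C r' w \<Longrightarrow> r' = r"
        using flow_maximal[OF m] by blast
      then show ?thesis
        using ivp_solution_eq_restrict[OF m, of C "{1..<r}"]
        by (intro exI[of _ r] exI[of _ "restrict (flow m C) {1..<r}"]) blast
    qed
    ultimately show ?thesis
      using full_solution_eq(1)[OF m pos] by (auto simp: is_threshold_def)
  qed
  have "?f M = 0" if M: "is_threshold m M"
  proof (rule ccontr)
    assume ne: "?f M \<noteq> 0"
    show False
    proof (cases "?f M < 0")
      case True
      then have "\<forall>\<^sub>F C in at M. ?f C < 0"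
        using order_tendstoD(2)[of ?f "?f M" "at M" 0] isCont_flow_end[OF m, of M]
        by (simp add: isCont_def)
      then obtain d where d: "0 < d" "\<And>C. C \<noteq> M \<Longrightarrow> dist C M < d \<Longrightarrow> ?f C < 0"
        by (auto simp: eventually_at)
      define C where "C = M - d / 2"
      have C: "?f C < 0" "C < M"
        using d(1) d(2)[of C] by (auto simp: C_def dist_real_def)
      then obtain v where "ivp_solution m C {1..m + 1} v"
        using M by (auto simp: is_threshold_def)
      moreover from this have "0 \<le> v (m + 1)"
        using m by (simp add: ivp_solution_def)
      ultimately show False
        using ivp_solution_eq_flow[OF m, of C "{1..m + 1}" v "m + 1"] C m by simp
    next
      case False
      with ne have pos: "0 < ?f M"
        by simp
      obtain r v where r: "r \<in> {1<..m + 1}" "maximal_solution m M r v"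
        using M unfolding is_threshold_def by blast
      obtain w where w: "ivp_solution m M {1..m + 1} w"
        using full_solution_eq(1)[OF m pos] by blast
      have "w x = v x" if "x \<in> {1..<r}" for x
        using ivp_solution_eq_flow[OF m, of M "{1..<r}" v x] ivp_solution_eq_flow[OF m w, of x] r that
        by (simp add: maximal_solution_def)
      moreover have "{1..r} \<subseteq> {1..m + 1}"
        using r by auto
      ultimately show False
        using r w unfolding maximal_solution_def continuable_beyond_def by blast
    qed
  qed
  with thr show ?thesis
    by blast
qed

theorem theorem2p3p2:
  fixes m :: real
  assumes "m > 0"
  shows "(\<exists>!M. M > 2 \<and> is_threshold m M) \<and>
    (\<forall>M. M > 2 \<and> is_threshold m M \<longrightarrow>
       (\<exists>!C. C < M \<and> full_solution m C (m + 1) = 2 * (m + 1)^2) \<and>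
       (\<forall>C. C < M \<and> full_solution m C (m + 1) = 2 * (m + 1)^2 \<longrightarrow> C > 2))"
proof -
  let ?f = "\<lambda>C. flow m C (m + 1)"
  have pos: "0 < 2 * (m + 1)^2"
    using assms by simp
  have f2: "2 * (m + 1)^2 < ?f 2"
    by (rule flow_2_end[OF assms])
  have f2': "0 < ?f 2"
    using f2 pos by linarith
  have cont: "continuous_on S ?f" for S
    using isCont_flow_end[OF assms] by (simp add: continuous_at_imp_continuous_on)
  have less: "?f C1 < ?f C2 \<longleftrightarrow> C2 < C1" for C1 C2
    by (rule flow_end_less_iff[OF assms])
  have inj: "C1 = C2" if "?f C1 = ?f C2" for C1 C2
    using less[of C1 C2] less[of C2 C1] that by force
  obtain N where N: "2 < N" "?f N < 0"
    using flow_end_neg[OF assms] by blast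
  have "\<exists>M\<ge>2. M \<le> N \<and> ?f M = 0"
    using N f2' by (intro IVT2' cont) auto
  then obtain M where M: "?f M = 0"
    by blast
  have M2: "2 < M"
    using less[of M 2] M f2' by simp
  have thr: "is_threshold m M' \<longleftrightarrow> M' = M" for M'
    using is_threshold_iff[OF assms, of M'] inj[of M' M] M by auto
  have full: "full_solution m C (m + 1) = ?f C" if "C < M" for C
    using full_solution_eq(2)[OF assms, of C] less[of M C] M that by simp
  \<comment> \<open>The target lies strictly between the end value 0 at \<open>M\<close> and the end
    value at 2.\<close>
  have "\<exists>C\<ge>2. C \<le> M \<and> ?f C = 2 * (m + 1)^2"
    using M M2 f2 by (intro IVT2' cont) auto
  then obtain C where C: "?f C = 2 * (m + 1)^2"
    by blast
  have "C < M"
    using less[of M C] M C pos by simp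
  then have "\<exists>!C. C < M \<and> full_solution m C (m + 1) = 2 * (m + 1)^2"
    using C full inj by metis
  moreover have "2 < C" if "C < M" "full_solution m C (m + 1) = 2 * (m + 1)^2" for C
    using less[of C 2] full[OF that(1)] that(2) f2 by simp
  ultimately show ?thesis
    using M2 thr by auto
qed

end
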